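(* Let $G=(V,E,w)$ be a weighted graph with $n$ nodes and $m$ edges and let $\beta$ be a hopbound parameter. Consider the greedy algorithm: start with $H\gets\emptyset$ and repeat, until $\phi(H)=0$, adding to $H$ the pair $(u,v)\in\mathrm{TC}(G)$, with weight $w(u,v):=\mathrm{dist}_G(u,v)$, that reduces as much as possible the quantity \[ \phi(H) := \sum_{\substack{(s,t)\in\mathrm{TC}(G)\\ \mathrm{hopdist}_{G\cup H}(s,t)\ge\beta}} \mathrm{hopdist}_{G\cup H}(s,t). \] Assume that $\mathrm{exopt}(n,m,\beta/2) \le m n^{o(1)}$, and that for some large enough $C = n^{o(1)}$ there exists $x = n^{o(1)}$ such that the tuple $(n,m,\beta/2)$ is $(C,x)$-critical. Then the output hopset $H$ has hopbound at most $\beta$ and $|H|\le m n^{o(1)}$.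
   Context: $\mathrm{TC}(G)$ is the transitive closure of $G$ (pairs $(s,t)$ such that $t$ is reachable from $s$). $\mathrm{dist}_G$ is weighted shortest-path distance. For a weighted graph, $\mathrm{hopdist}(s,t)$ is the fewest number of edges of any shortest (minimum-weight) $s\to t$ path. A hopset with hopbound $\beta$ for $G$ is a set $H\subseteq V\times V$ of pairs of $\mathrm{TC}(G)$, each added as an edge of weight $\mathrm{dist}_G(u,v)$, such that every $(s,t)\in\mathrm{TC}(G)$ satisfies $\mathrm{hopdist}_{G\cup H}(s,t)\le\beta$. $\mathrm{exopt}(n,m,\beta)$ is the least integer such that every weighted input graph with at most $n$ nodes and at most $m$ edges has a hopset with at most $\mathrm{exopt}(n,m,\beta)$ edges and hopbound at most $\beta$. A tuple $(n,m,\beta)$ is $(C,x)$-critical if $\mathrm{exopt}(n, m\cdot(Cx), \beta)\le \mathrm{exopt}(n,m,\beta)\cdot x$. *)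

theory Defs
  imports "Graph_Theory.Graph_Theory" "HOL-Library.Extended_Nat" "HOL-Library.Extended_Real"
begin

text \<open>Finite digraphs with nonnegative real arc weights. Loops are permitted; they lie on no
  fewest-arc shortest path.\<close>

definition weighted_graph :: "'a pair_pre_digraph \<Rightarrow> ('a \<times> 'a \<Rightarrow> real) \<Rightarrow> bool" where
  "weighted_graph G w \<longleftrightarrow> pair_fin_digraph G \<and> (\<forall>e\<in>parcs G. 0 \<le> w e)"

definition TC :: "'a pair_pre_digraph \<Rightarrow> 'a rel" where
  "TC G = {(s, t). s \<rightarrow>\<^sup>*\<^bsub>with_proj G\<^esub> t}"

definition wdist :: "'a pair_pre_digraph \<Rightarrow> ('a \<times> 'a \<Rightarrow> real) \<Rightarrow> 'a \<Rightarrow> 'a \<Rightarrow> ereal" where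
  "wdist G w s t = wf_digraph.\<mu> (with_proj G) w s t"

text \<open>Only meaningful for \<open>(s, t) \<in> TC G\<close>.\<close>

definition hopdist :: "'a pair_pre_digraph \<Rightarrow> ('a \<times> 'a \<Rightarrow> real) \<Rightarrow> 'a \<Rightarrow> 'a \<Rightarrow> nat" where
  "hopdist G w s t = (LEAST k. \<exists>p. pre_digraph.awalk (with_proj G) s p t \<and>
     ereal (wf_digraph.awalk_cost w p) = wdist G w s t \<and> length p = k)"

text \<open>The graph \<open>G \<union> H\<close>. An arc of \<open>G\<close> that is also in \<open>H\<close> gets the weight \<open>dist\<^sub>G\<close>, which is
  never larger than its old one, so no parallel copy has to be kept.\<close>

definition add_pairs :: "'a pair_pre_digraph \<Rightarrow> 'a rel \<Rightarrow> 'a pair_pre_digraph" where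
  "add_pairs G H = G\<lparr>parcs := parcs G \<union> H\<rparr>"

definition add_weight ::
    "'a pair_pre_digraph \<Rightarrow> ('a \<times> 'a \<Rightarrow> real) \<Rightarrow> 'a rel \<Rightarrow> ('a \<times> 'a \<Rightarrow> real)" where
  "add_weight G w H = (\<lambda>(u, v). if (u, v) \<in> H then real_of_ereal (wdist G w u v) else w (u, v))"

definition hopdist_with ::
    "'a pair_pre_digraph \<Rightarrow> ('a \<times> 'a \<Rightarrow> real) \<Rightarrow> 'a rel \<Rightarrow> 'a \<Rightarrow> 'a \<Rightarrow> nat" where
  "hopdist_with G w H s t = hopdist (add_pairs G H) (add_weight G w H) s t"

text \<open>The hopbound is real, so that \<open>\<beta> / 2\<close> makes sense for odd \<open>\<beta>\<close>.\<close>

definition hopset ::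
    "'a pair_pre_digraph \<Rightarrow> ('a \<times> 'a \<Rightarrow> real) \<Rightarrow> real \<Rightarrow> 'a rel \<Rightarrow> bool" where
  "hopset G w b H \<longleftrightarrow> H \<subseteq> TC G \<and> (\<forall>(s, t)\<in>TC G. real (hopdist_with G w H s t) \<le> b)"

text \<open>The edge budget is real, as it is instantiated to \<open>m * (C * x)\<close>. The value is \<open>\<infinity>\<close> when no
  such integer exists (which happens only for \<open>b < 1\<close>). Every finite graph is isomorphic to one
  with vertices in \<^typ>\<open>nat\<close>.\<close>

definition exopt :: "nat \<Rightarrow> real \<Rightarrow> real \<Rightarrow> enat" where
  "exopt n m b = Inf {enat k | k. \<forall>(G :: nat pair_pre_digraph) w.
     weighted_graph G w \<and> card (pverts G) \<le> n \<and> real (card (parcs G)) \<le> m \<longrightarrow>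
     (\<exists>H. hopset G w b H \<and> card H \<le> k)}"

definition critical :: "real \<Rightarrow> real \<Rightarrow> nat \<Rightarrow> real \<Rightarrow> real \<Rightarrow> bool" where
  "critical C x n m b \<longleftrightarrow>
     ereal_of_enat (exopt n (m * (C * x)) b) \<le> ereal_of_enat (exopt n m b) * ereal x"

definition \<phi> :: "'a pair_pre_digraph \<Rightarrow> ('a \<times> 'a \<Rightarrow> real) \<Rightarrow> nat \<Rightarrow> 'a rel \<Rightarrow> nat" where
  "\<phi> G w \<beta> H =
     (\<Sum>(s, t) \<in> {(s, t) \<in> TC G. hopdist_with G w H s t \<ge> \<beta>}. hopdist_with G w H s t)"

text \<open>One iteration of the greedy loop. It is a relation because ties may be broken arbitrarily.\<close>

definition greedy_step ::
    "'a pair_pre_digraph \<Rightarrow> ('a \<times> 'a \<Rightarrow> real) \<Rightarrow> nat \<Rightarrow> 'a rel \<Rightarrow> 'a rel \<Rightarrow> bool" where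
  "greedy_step G w \<beta> H H' \<longleftrightarrow> \<phi> G w \<beta> H \<noteq> 0 \<and>
     (\<exists>p\<in>TC G. H' = insert p H \<and> (\<forall>q\<in>TC G. \<phi> G w \<beta> (insert p H) \<le> \<phi> G w \<beta> (insert q H)))"

definition greedy_output ::
    "'a pair_pre_digraph \<Rightarrow> ('a \<times> 'a \<Rightarrow> real) \<Rightarrow> nat \<Rightarrow> 'a rel \<Rightarrow> bool" where
  "greedy_output G w \<beta> H \<longleftrightarrow> (greedy_step G w \<beta>)\<^sup>*\<^sup>* {} H \<and> \<phi> G w \<beta> H = 0"

definition greedy_terminates ::
    "'a pair_pre_digraph \<Rightarrow> ('a \<times> 'a \<Rightarrow> real) \<Rightarrow> nat \<Rightarrow> bool" where
  "greedy_terminates G w \<beta> \<longleftrightarrow>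
     \<not> (\<exists>R. R 0 = {} \<and> (\<forall>i :: nat. greedy_step G w \<beta> (R i) (R (Suc i))))"

text \<open>\<open>f(n) = n\<^sup>o\<^sup>(\<^sup>1\<^sup>)\<close> as \<open>n \<rightarrow> \<infinity>\<close>.\<close>

definition n_pow_o1 :: "(nat \<Rightarrow> real) \<Rightarrow> bool" where
  "n_pow_o1 f \<longleftrightarrow> (\<exists>e :: nat \<Rightarrow> real. e \<longlonglongrightarrow> 0 \<and> (\<forall>\<^sub>F n in sequentially. f n = real n powr e n))"

end

theory Submission
  imports Defs "HOL-Real_Asymp.Real_Asymp"
begin

text \<open>Let \<open>G \<union> H\<close> be the current graph and perturb its weights to \<open>w + \<epsilon>\<close>, so that a shortest walk
  is also one with the fewest arcs among the shortest ones. As long as \<open>G \<union> H\<close> has at most \<open>m C x\<close>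
  arcs, the perturbed graph has a hopset \<open>J\<close> with hopbound \<open>\<beta> / 2\<close> and, by criticality, at most
  \<open>K \<le> m f x\<close> arcs. Expanding the arcs of \<open>J\<close> on a shortest \<open>s\<close>-\<open>t\<close> walk gives a fewest-arc
  shortest walk, so the amounts by which the single arcs of \<open>J\<close> reduce the hop distance of \<open>(s, t)\<close>
  sum up to at least \<open>hopdist - \<beta> / 2\<close>, which is at least half the hop distance if that is at
  least \<open>\<beta>\<close>. By averaging, some arc reduces \<open>\<phi>\<close> by a factor \<open>1 - 1 / (2 K)\<close>. Initially
  \<open>\<phi> \<le> n\<^sup>3\<close>, so \<open>\<phi>\<close> vanishes after at most \<open>6 K ln n + 1\<close> steps, and with \<open>C \<ge> 2 + 6 f ln n\<close> the
  arc budget \<open>m C x\<close> is not exceeded until then.\<close>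

section \<open>Walks with given cost and length\<close>

text \<open>Cost and number of arcs are recorded jointly, since the argument compares walks by both;
  the arc list itself stays hidden.\<close>

definition has_walk ::
    "'a pair_pre_digraph \<Rightarrow> ('a \<times> 'a \<Rightarrow> real) \<Rightarrow> 'a \<Rightarrow> 'a \<Rightarrow> real \<Rightarrow> nat \<Rightarrow> bool" where
  "has_walk G w s t c k \<longleftrightarrow>
     (\<exists>p. pre_digraph.awalk (with_proj G) s p t \<and> sum_list (map w p) = c \<and> length p = k)"

text \<open>Allows real arithmetic; on \<open>TC G\<close> nothing is lost, as \<open>wdist\<close>
  is finite there for weighted graphs.\<close>

definition rdist :: "'a pair_pre_digraph \<Rightarrow> ('a \<times> 'a \<Rightarrow> real) \<Rightarrow> 'a \<Rightarrow> 'a \<Rightarrow> real" where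
  "rdist G w s t = real_of_ereal (wdist G w s t)"

lemma weighted_graph_wf: "weighted_graph G w \<Longrightarrow> wf_digraph (with_proj G)"
  by (simp add: weighted_graph_def pair_fin_digraph_def wf_digraph_wp_iff)

lemma weighted_graph_finite:
  assumes "weighted_graph G w"
  shows "finite (pverts G)" "finite (parcs G)"
  using assms by (auto simp: weighted_graph_def pair_fin_digraph_def pair_fin_digraph_axioms_def)

lemma weighted_graph_arc:
  assumes "weighted_graph G w" "(u, v) \<in> parcs G"
  shows "u \<in> pverts G" "v \<in> pverts G" "0 \<le> w (u, v)"
  using assms by (auto simp: weighted_graph_def pair_fin_digraph_def pair_wf_digraph_def)

lemma weighted_graphI:
  assumes "finite (pverts G)" "parcs G \<subseteq> pverts G \<times> pverts G" "\<And>e. e \<in> parcs G \<Longrightarrow> 0 \<le> w e"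
  shows "weighted_graph G w"
proof -
  have "finite (parcs G)"
    using assms(1,2) by (meson finite_SigmaI finite_subset)
  then show ?thesis
    using assms unfolding weighted_graph_def pair_fin_digraph_def pair_wf_digraph_def
      pair_fin_digraph_axioms_def by auto
qed

lemma has_walk_refl: "v \<in> pverts G \<Longrightarrow> has_walk G w v v 0 0"
  unfolding has_walk_def by (intro exI[of _ "[]"]) (simp add: pre_digraph.awalk_def pre_digraph.cas.simps)

lemma has_walk_arc:
  assumes "weighted_graph G w" "(u, v) \<in> parcs G"
  shows "has_walk G w' u v (w' (u, v)) 1"
  unfolding has_walk_def
  using weighted_graph_arc[OF assms] assms(2)
  by (intro exI[of _ "[(u, v)]"]) (simp add: pre_digraph.awalk_def pre_digraph.cas.simps)

lemma has_walk_append: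
  assumes "weighted_graph G w0" "has_walk G w s u c k" "has_walk G w u t d l"
  shows "has_walk G w s t (c + d) (k + l)"
proof -
  interpret wf_digraph "with_proj G" using assms(1) by (rule weighted_graph_wf)
  show ?thesis
    using assms(2,3) unfolding has_walk_def by (auto 4 4 intro: awalk_appendI)
qed

lemma has_walk_verts:
  assumes "weighted_graph G w0" "has_walk G w s t c k"
  shows "s \<in> pverts G" "t \<in> pverts G"
proof -
  interpret wf_digraph "with_proj G" using assms(1) by (rule weighted_graph_wf)
  show "s \<in> pverts G" "t \<in> pverts G"
    using assms(2) awalk_hd_in_verts awalk_last_in_verts unfolding has_walk_def by fastforce+
qed

text \<open>Walks grow at their right end while the source stays fixed, which suits claims about
  distances from \<open>s\<close>.\<close>

lemma has_walk_induct [consumes 2, case_names refl arc]: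
  assumes "weighted_graph G w0" "has_walk G w s t c k"
    and "s \<in> pverts G \<Longrightarrow> P s 0 0"
    and "\<And>u t c k. has_walk G w s u c k \<Longrightarrow> P u c k \<Longrightarrow> (u, t) \<in> parcs G \<Longrightarrow>
           P t (c + w (u, t)) (Suc k)"
  shows "P t c k"
proof -
  interpret wf_digraph "with_proj G" using assms(1) by (rule weighted_graph_wf)
  obtain p where p: "awalk s p t" "sum_list (map w p) = c" "length p = k"
    using assms(2) unfolding has_walk_def by blast
  then show ?thesis
  proof (induction p arbitrary: t c k rule: rev_induct)
    case Nil
    then show ?case using assms(3) by (auto simp: awalk_Nil_iff)
  next
    case (snoc e p)
    obtain u v where e: "e = (u, v)" by fastforce
    from snoc.prems(1) e have *: "awalk s p u" "v = t" "(u, t) \<in> parcs G"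
      by (auto simp: awalk_append_iff awalk_Cons_iff awalk_Nil_iff dest: awalk_ends)
    have w: "has_walk G w s u (sum_list (map w p)) (length p)"
      using * unfolding has_walk_def by blast
    show ?case
      using assms(4)[OF w snoc.IH[OF *(1) refl refl] *(3)] snoc.prems(2,3) e * by simp
  qed
qed

lemma has_walk_nonneg:
  assumes "weighted_graph G w" "has_walk G w s t c k"
  shows "0 \<le> c"
  using assms(1,2)
  by (induction rule: has_walk_induct) (auto dest: weighted_graph_arc(3)[OF assms(1)])

lemma TC_iff_has_walk:
  assumes "weighted_graph G w0"
  shows "(s, t) \<in> TC G \<longleftrightarrow> (\<exists>c k. has_walk G w s t c k)"
proof -
  interpret wf_digraph "with_proj G" using assms(1) by (rule weighted_graph_wf)
  show ?thesis by (auto simp: TC_def reachable_awalk has_walk_def)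
qed

lemma has_walk_TC:
  assumes "weighted_graph G w0" "has_walk G w s t c k"
  shows "(s, t) \<in> TC G"
  using assms TC_iff_has_walk[OF assms(1), where w = w] by blast

lemma TC_verts:
  assumes "weighted_graph G w"
  shows "TC G \<subseteq> pverts G \<times> pverts G"
  using TC_iff_has_walk[OF assms, where w = w] has_walk_verts[OF assms, where w = w] by auto

lemma TC_finite: "weighted_graph G w \<Longrightarrow> finite (TC G)"
  using TC_verts weighted_graph_finite(1) by (metis finite_SigmaI finite_subset)

text \<open>Cutting out cycles cannot raise the cost, because closed walks have nonnegative cost,
  and the remaining path has fewer arcs than there are vertices.\<close>

lemma has_walk_short:
  assumes "weighted_graph G w" "has_walk G w s t c k"
  obtains c' k' where "has_walk G w s t c' k'" "c' \<le> c" "k' \<le> k" "k' < card (pverts G)"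
proof -
  interpret fin_digraph "with_proj G"
    using assms(1) weighted_graph_wf weighted_graph_finite
    by (auto simp: fin_digraph_def fin_digraph_axioms_def)
  obtain p where p: "awalk s p t" "sum_list (map w p) = c" "length p = k"
    using assms(2) unfolding has_walk_def by blast
  have "\<exists>q. apath s q t \<and> sum_list (map w q) \<le> sum_list (map w p) \<and> length q \<le> length p"
    using p(1)
  proof (induction rule: awalk_to_apath_induct)
    case (path p)
    then show ?case by (auto simp: apath_def)
  next
    case (decomp p q r t')
    then obtain v where v: "p = q @ r @ t'" "awalk v r v"
      by (auto elim: awalk_cyc_decompE)
    have "0 \<le> sum_list (map w r)"
      using has_walk_nonneg[OF assms(1)] v(2) unfolding has_walk_def by blast
    then show ?case using decomp.IH v by fastforce
  qed
  then obtain q where q: "apath s q t" "sum_list (map w q) \<le> c" "length q \<le> k"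
    using p by blast
  have "length q < card (pverts G)"
    using length_apath_less[OF q(1)] by simp
  with q show ?thesis
    using that unfolding has_walk_def apath_def by blast
qed

lemma finite_short_walk_costs:
  assumes "weighted_graph G w0"
  shows "finite {c. \<exists>s t. \<exists>k\<le>N. has_walk G w s t c k}"
proof (rule finite_subset)
  show "{c. \<exists>s t. \<exists>k\<le>N. has_walk G w s t c k} \<subseteq>
      (\<lambda>p. sum_list (map w p)) ` {p. set p \<subseteq> parcs G \<and> length p \<le> N}"
    unfolding has_walk_def pre_digraph.awalk_def by auto
  show "finite \<dots>"
    using weighted_graph_finite(2)[OF assms] by (intro finite_imageI finite_lists_length_le)
qed

section \<open>Distances and hop distances as attained minima\<close>

lemma wdist_attained:
  assumes "weighted_graph G w" "(s, t) \<in> TC G"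
  obtains d k where "wdist G w s t = ereal d" "has_walk G w s t d k"
    "\<And>c l. has_walk G w s t c l \<Longrightarrow> d \<le> c"
proof -
  interpret wf_digraph "with_proj G" using assms(1) by (rule weighted_graph_wf)
  \<comment> \<open>The infimum over all walks reduces to a minimum over this finite set, because
    shortening puts an element of \<open>S\<close> below every walk cost.\<close>
  define S where "S = {c. \<exists>k \<le> card (pverts G). has_walk G w s t c k}"
  have fin: "finite S"
    by (rule finite_subset[OF _ finite_short_walk_costs[OF assms(1), of "card (pverts G)" w]])
      (auto simp: S_def)
  have short: "\<exists>c'\<in>S. c' \<le> c" if "has_walk G w s t c k" for c k
    by (rule has_walk_short[OF assms(1) that]) (use less_imp_le in \<open>auto simp: S_def\<close>)
  have "S \<noteq> {}"
    using short assms(2) unfolding TC_iff_has_walk[OF assms(1), where w = w] by blast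
  then have "Min S \<in> S" using fin by simp
  then obtain k where k: "has_walk G w s t (Min S) k" by (auto simp: S_def)
  have le: "Min S \<le> c" if "has_walk G w s t c l" for c l
    using short[OF that] Min_le[OF fin] by fastforce
  have "wdist G w s t = ereal (Min S)"
    unfolding wdist_def \<mu>_def
  proof (rule antisym)
    show "(INF p\<in>{p. awalk s p t}. ereal (awalk_cost w p)) \<le> ereal (Min S)"
      using k unfolding has_walk_def awalk_cost_def by (auto intro: INF_lower2)
    show "ereal (Min S) \<le> (INF p\<in>{p. awalk s p t}. ereal (awalk_cost w p))"
      using le unfolding has_walk_def awalk_cost_def by (intro INF_greatest) auto
  qed
  with k le that show ?thesis by blast
qed

lemma rdist_walk:
  assumes "weighted_graph G w" "(s, t) \<in> TC G"
  shows "\<exists>k. has_walk G w s t (rdist G w s t) k"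
  by (rule wdist_attained[OF assms]) (auto simp: rdist_def)

lemma rdist_le:
  assumes "weighted_graph G w" "has_walk G w s t c k"
  shows "rdist G w s t \<le> c"
proof -
  have "(s, t) \<in> TC G" using assms by (rule has_walk_TC)
  then show ?thesis
    by (rule wdist_attained[OF assms(1)]) (use assms(2) in \<open>auto simp: rdist_def\<close>)
qed

lemma rdist_nonneg:
  assumes "weighted_graph G w" "(s, t) \<in> TC G"
  shows "0 \<le> rdist G w s t"
  using rdist_walk[OF assms] has_walk_nonneg[OF assms(1)] by blast

lemma hopdist_eq:
  assumes "weighted_graph G w" "(s, t) \<in> TC G"
  shows "hopdist G w s t = (LEAST k. has_walk G w s t (rdist G w s t) k)"
proof -
  interpret wf_digraph "with_proj G" using assms(1) by (rule weighted_graph_wf)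
  obtain d where d: "wdist G w s t = ereal d" by (rule wdist_attained[OF assms])
  show ?thesis
    unfolding hopdist_def has_walk_def rdist_def d by (simp add: awalk_cost_def)
qed

lemma hopdist_walk:
  assumes "weighted_graph G w" "(s, t) \<in> TC G"
  shows "has_walk G w s t (rdist G w s t) (hopdist G w s t)"
  unfolding hopdist_eq[OF assms] by (rule LeastI_ex[OF rdist_walk[OF assms]])

lemma hopdist_le:
  assumes "weighted_graph G w" "has_walk G w s t (rdist G w s t) k"
  shows "hopdist G w s t \<le> k"
proof -
  have "(s, t) \<in> TC G" using assms by (rule has_walk_TC)
  then show ?thesis
    using hopdist_eq[OF assms(1)] assms(2) by (metis Least_le)
qed

text \<open>Shortening a fewest-arc shortest walk does not raise its cost, so the result is still
  shortest.\<close>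

lemma hopdist_less_card:
  assumes "weighted_graph G w" "(s, t) \<in> TC G"
  shows "hopdist G w s t < card (pverts G)"
proof -
  obtain c k where ck: "has_walk G w s t c k" "c \<le> rdist G w s t" "k < card (pverts G)"
    using has_walk_short[OF assms(1) hopdist_walk[OF assms]] by metis
  with rdist_le[OF assms(1) ck(1)] have "has_walk G w s t (rdist G w s t) k" by simp
  then show ?thesis using hopdist_le[OF assms(1)] ck(3) by (meson le_less_trans)
qed

section \<open>Triangle inequalities\<close>

lemma TC_trans:
  assumes "weighted_graph G w" "(s, u) \<in> TC G" "(u, t) \<in> TC G"
  shows "(s, t) \<in> TC G"
  using has_walk_TC[OF assms(1) has_walk_append[OF assms(1) hopdist_walk[OF assms(1,2)]
        hopdist_walk[OF assms(1,3)]]] .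

lemma arc_in_TC: "weighted_graph G w \<Longrightarrow> (u, v) \<in> parcs G \<Longrightarrow> (u, v) \<in> TC G"
  by (rule has_walk_TC[OF _ has_walk_arc])

lemma rdist_triangle:
  assumes "weighted_graph G w" "(s, u) \<in> TC G" "(u, t) \<in> TC G"
  shows "rdist G w s t \<le> rdist G w s u + rdist G w u t"
  using has_walk_append[OF assms(1) hopdist_walk[OF assms(1,2)] hopdist_walk[OF assms(1,3)]]
  by (rule rdist_le[OF assms(1)])

lemma rdist_arc: "weighted_graph G w \<Longrightarrow> (u, v) \<in> parcs G \<Longrightarrow> rdist G w u v \<le> w (u, v)"
  by (rule rdist_le[OF _ has_walk_arc])

lemma hopdist_triangle:
  assumes "weighted_graph G w" "(s, u) \<in> TC G" "(u, t) \<in> TC G"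
    and "rdist G w s t = rdist G w s u + rdist G w u t"
  shows "hopdist G w s t \<le> hopdist G w s u + hopdist G w u t"
  using has_walk_append[OF assms(1) hopdist_walk[OF assms(1,2)] hopdist_walk[OF assms(1,3)]]
    assms(4) hopdist_le[OF assms(1)] by metis

section \<open>Weight-decreasing homomorphisms\<close>

text \<open>Covers both uses: adding shortcuts, where the map is the identity and a shortcut may
  lower the weight of an arc, and renaming vertices to natural numbers.\<close>

definition weighted_hom ::
    "'a pair_pre_digraph \<Rightarrow> ('a \<times> 'a \<Rightarrow> real) \<Rightarrow> 'b pair_pre_digraph \<Rightarrow> ('b \<times> 'b \<Rightarrow> real) \<Rightarrow>
     ('a \<Rightarrow> 'b) \<Rightarrow> bool" where
  "weighted_hom G w G' w' h \<longleftrightarrow> h ` pverts G \<subseteq> pverts G' \<and>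
     (\<forall>u v. (u, v) \<in> parcs G \<longrightarrow> (h u, h v) \<in> parcs G' \<and> w' (h u, h v) \<le> w (u, v))"

lemma has_walk_hom:
  assumes "weighted_graph G w" "weighted_graph G' w'" "weighted_hom G w G' w' h"
    and "has_walk G w s t c k"
  obtains c' where "c' \<le> c" "has_walk G' w' (h s) (h t) c' k"
proof -
  have "\<exists>c'\<le>c. has_walk G' w' (h s) (h t) c' k"
    using assms(1,4)
  proof (induction rule: has_walk_induct)
    case refl
    then show ?case
      using assms(3) has_walk_refl[of "h s" G' w'] unfolding weighted_hom_def
      by (intro exI[of _ 0]) auto
  next
    case (arc u t c k)
    then obtain c' where c': "c' \<le> c" "has_walk G' w' (h s) (h u) c' k" by blast
    have e: "(h u, h t) \<in> parcs G'" "w' (h u, h t) \<le> w (u, t)"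
      using assms(3) arc.hyps(2) unfolding weighted_hom_def by auto
    show ?case
      using has_walk_append[OF assms(2) c'(2) has_walk_arc[OF assms(2) e(1), of w']] c'(1) e(2)
      by (intro exI[of _ "c' + w' (h u, h t)"]) simp
  qed
  then show ?thesis using that by blast
qed

lemma TC_hom:
  assumes "weighted_graph G w" "weighted_graph G' w'" "weighted_hom G w G' w' h" "(s, t) \<in> TC G"
  shows "(h s, h t) \<in> TC G'"
  by (rule has_walk_hom[OF assms(1-3) hopdist_walk[OF assms(1,4)]]) (rule has_walk_TC[OF assms(2)])

lemma rdist_hom:
  assumes "weighted_graph G w" "weighted_graph G' w'" "weighted_hom G w G' w' h" "(s, t) \<in> TC G"
  shows "rdist G' w' (h s) (h t) \<le> rdist G w s t"
  by (rule has_walk_hom[OF assms(1-3) hopdist_walk[OF assms(1,4)]])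
    (use rdist_le[OF assms(2)] in \<open>force intro: order_trans\<close>)

text \<open>The image of a fewest-arc shortest walk has equally many arcs and no larger cost;
  equality of the distances makes it a shortest walk again.\<close>

lemma hopdist_hom:
  assumes "weighted_graph G w" "weighted_graph G' w'" "weighted_hom G w G' w' h" "(s, t) \<in> TC G"
    and "rdist G' w' (h s) (h t) = rdist G w s t"
  shows "hopdist G' w' (h s) (h t) \<le> hopdist G w s t"
proof -
  obtain c where c: "c \<le> rdist G w s t" "has_walk G' w' (h s) (h t) c (hopdist G w s t)"
    using has_walk_hom[OF assms(1-3) hopdist_walk[OF assms(1,4)]] .
  with rdist_le[OF assms(2) c(2)] assms(5) show ?thesis
    using hopdist_le[OF assms(2)] by simp
qed

section \<open>Adding shortcut arcs\<close>

lemma add_pairs_simps [simp]: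
  "pverts (add_pairs G H) = pverts G" "parcs (add_pairs G H) = parcs G \<union> H"
  by (simp_all add: add_pairs_def)

lemma add_pairs_empty [simp]: "add_pairs G {} = G"
  by (simp add: add_pairs_def)

lemma add_weight_empty [simp]: "add_weight G w {} = w"
  by (auto simp: add_weight_def)

lemma add_weight_eq: "add_weight G w H (u, v) = (if (u, v) \<in> H then rdist G w u v else w (u, v))"
  by (simp add: add_weight_def rdist_def)

context
  fixes G :: "'a pair_pre_digraph" and w
  assumes G: "weighted_graph G w"
begin

lemma weighted_graph_add:
  assumes "H \<subseteq> TC G"
  shows "weighted_graph (add_pairs G H) (add_weight G w H)"
proof (rule weighted_graphI)
  show "parcs (add_pairs G H) \<subseteq> pverts (add_pairs G H) \<times> pverts (add_pairs G H)"
    using assms TC_verts[OF G] weighted_graph_arc[OF G] by auto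
  show "0 \<le> add_weight G w H e" if "e \<in> parcs (add_pairs G H)" for e
    using that assms rdist_nonneg[OF G] weighted_graph_arc(3)[OF G] by (cases e) (auto simp: add_weight_eq)
qed (simp add: weighted_graph_finite[OF G])

lemma weighted_hom_add:
  assumes "H \<subseteq> H'"
  shows "weighted_hom (add_pairs G H) (add_weight G w H) (add_pairs G H') (add_weight G w H') id"
  using assms rdist_arc[OF G] by (auto simp: weighted_hom_def add_weight_eq)

text \<open>Every arc of the enlarged graph weighs at least the \<open>G\<close>-distance of its
  ends, so shortcuts create neither new reachable pairs nor smaller distances.\<close>

lemma has_walk_add_expand:
  assumes "H \<subseteq> TC G" "has_walk (add_pairs G H) (add_weight G w H) s t c k"
  shows "(s, t) \<in> TC G \<and> rdist G w s t \<le> c"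
  using weighted_graph_add[OF assms(1)] assms(2)
proof (induction rule: has_walk_induct)
  case refl
  then have "has_walk G w s s 0 0" by (simp add: has_walk_refl)
  then show ?case using has_walk_TC[OF G] rdist_le[OF G] by blast
next
  case (arc u t c k)
  have ut: "(u, t) \<in> TC G"
    using arc.hyps(2) assms(1) arc_in_TC[OF G] by auto
  have "rdist G w u t \<le> add_weight G w H (u, t)"
    using arc.hyps(2) rdist_arc[OF G] by (auto simp: add_weight_eq)
  then show ?case
    using arc.IH TC_trans[OF G _ ut] rdist_triangle[OF G _ ut] by fastforce
qed

lemma TC_add:
  assumes "H \<subseteq> TC G"
  shows "TC (add_pairs G H) = TC G"
proof -
  note G' = weighted_graph_add[OF assms]
  have "(s, t) \<in> TC (add_pairs G H) \<longleftrightarrow> (s, t) \<in> TC G" for s t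
    using has_walk_add_expand[OF assms hopdist_walk[OF G']]
      TC_hom[OF G G', of id s t] weighted_hom_add[of "{}" H] by auto
  then show ?thesis by auto
qed

lemma rdist_add:
  assumes "H \<subseteq> TC G" "(s, t) \<in> TC G"
  shows "rdist (add_pairs G H) (add_weight G w H) s t = rdist G w s t"
proof (rule antisym)
  note G' = weighted_graph_add[OF assms(1)]
  show "rdist (add_pairs G H) (add_weight G w H) s t \<le> rdist G w s t"
    using rdist_hom[OF G G', of id s t] weighted_hom_add[of "{}" H] assms(2) by simp
  show "rdist G w s t \<le> rdist (add_pairs G H) (add_weight G w H) s t"
    using has_walk_add_expand[OF assms(1)] hopdist_walk[OF G', of s t] TC_add[OF assms(1)] assms(2)
    by blast
qed

lemma hopdist_with_antimono:
  assumes "H \<subseteq> H'" "H' \<subseteq> TC G" "(s, t) \<in> TC G"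
  shows "hopdist_with G w H' s t \<le> hopdist_with G w H s t"
proof -
  have H: "H \<subseteq> TC G" using assms by blast
  show ?thesis
    using hopdist_hom[OF weighted_graph_add[OF H] weighted_graph_add[OF assms(2)]
        weighted_hom_add[OF assms(1)], of s t]
      rdist_add[OF H assms(3)] rdist_add[OF assms(2,3)] TC_add[OF H] assms(3)
    by (simp add: hopdist_with_def)
qed

lemma hopdist_with_shortcut:
  assumes "H \<subseteq> TC G" "(s, t) \<in> H"
  shows "hopdist_with G w H s t \<le> 1"
proof -
  note G' = weighted_graph_add[OF assms(1)]
  have "has_walk (add_pairs G H) (add_weight G w H) s t (rdist G w s t) 1"
    using has_walk_arc[OF G', of s t "add_weight G w H"] assms(2) by (simp add: add_weight_eq)
  then show ?thesis
    using hopdist_le[OF G', of s t 1] rdist_add[OF assms(1), of s t] assms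
    unfolding hopdist_with_def by auto
qed

lemma hopdist_with_triangle:
  assumes "H \<subseteq> TC G" "(s, u) \<in> TC G" "(u, t) \<in> TC G"
    and "rdist G w s t = rdist G w s u + rdist G w u t"
  shows "hopdist_with G w H s t \<le> hopdist_with G w H s u + hopdist_with G w H u t"
  using hopdist_triangle[OF weighted_graph_add[OF assms(1)], of s u t] assms
    TC_trans[OF G assms(2,3)]
  by (simp add: hopdist_with_def TC_add rdist_add)

text \<open>Distances agree before and after adding \<open>H\<close>, so the new pair gets the same
  weight either way. Hence the gain of one more pair can be studied with the current graph as base
  graph.\<close>

lemma hopdist_with_insert:
  assumes "H \<subseteq> TC G" "e \<in> TC G"
  shows "hopdist_with (add_pairs G H) (add_weight G w H) {e} s t = hopdist_with G w (insert e H) s t"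
proof -
  have "add_weight (add_pairs G H) (add_weight G w H) {e} = add_weight G w (insert e H)"
    using rdist_add[OF assms(1)] assms(2) by (auto simp: fun_eq_iff add_weight_eq)
  then show ?thesis
    by (simp add: hopdist_with_def add_pairs_def Un_insert_right)
qed

lemma hopdist_with_le_card:
  assumes "H \<subseteq> TC G" "(s, t) \<in> TC G"
  shows "hopdist_with G w H s t \<le> card (pverts G)"
  using hopdist_less_card[OF weighted_graph_add[OF assms(1)], of s t] assms
  by (simp add: hopdist_with_def TC_add)

end

section \<open>Perturbed weights\<close>

text \<open>Shortest walks for \<open>w + \<epsilon>\<close> are exactly the shortest walks for \<open>w\<close> with the fewest arcs.\<close>

definition hop_separating :: "'a pair_pre_digraph \<Rightarrow> ('a \<times> 'a \<Rightarrow> real) \<Rightarrow> real \<Rightarrow> bool" where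
  "hop_separating G w \<epsilon> \<longleftrightarrow> 0 < \<epsilon> \<and>
     (\<forall>s t c k. has_walk G w s t c k \<longrightarrow>
        c + \<epsilon> * real k \<le> rdist G w s t + \<epsilon> * real (hopdist G w s t) \<longrightarrow>
        c = rdist G w s t \<and> k = hopdist G w s t)"

text \<open>Distinct costs of walks with at most \<open>N\<close> arcs differ by at least some
  \<delta> > 0, and with \<open>\<epsilon> * N < \<delta>\<close> the perturbation cannot outweigh
  such a difference. Longer walks are handled through their shortened versions.\<close>

lemma hop_separating_exists:
  assumes G: "weighted_graph G w"
  shows "\<exists>\<epsilon>. hop_separating G w \<epsilon>"
proof -
  define N where "N = card (pverts G)"
  define S where "S = {c. \<exists>s t. \<exists>k\<le>N. has_walk G w s t c k}"
  \<comment> \<open>The element \<open>1\<close> keeps \<open>D\<close> nonempty when no two costs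
    differ.\<close>
  define D where "D = insert 1 ((\<lambda>(c, d). c - d) ` {(c, d) \<in> S \<times> S. d < c})"
  define \<delta> where "\<delta> = Min D"
  \<comment> \<open>Dividing by \<open>N + 1\<close> makes \<open>\<epsilon> * N < \<delta>\<close>
    strict.\<close>
  define \<epsilon> where "\<epsilon> = \<delta> / real (N + 1)"
  have "finite S" unfolding S_def by (rule finite_short_walk_costs[OF G])
  then have "finite {(c, d) \<in> S \<times> S. d < c}"
    by (intro finite_subset[OF _ finite_cartesian_product[of S S]]) auto
  then have "finite D" unfolding D_def by simp
  moreover have "D \<noteq> {}" "\<forall>d\<in>D. 0 < d" by (auto simp: D_def)
  ultimately have \<delta>: "0 < \<delta>" and \<delta>_le: "\<And>d. d \<in> D \<Longrightarrow> \<delta> \<le> d"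
    unfolding \<delta>_def by auto
  have \<epsilon>: "0 < \<epsilon>" "\<epsilon> * real N < \<delta>"
    using \<delta> by (auto simp: \<epsilon>_def field_simps)
  have "c = rdist G w s t \<and> k = hopdist G w s t"
    if walk: "has_walk G w s t c k"
      and le: "c + \<epsilon> * real k \<le> rdist G w s t + \<epsilon> * real (hopdist G w s t)" for s t c k
  proof -
    obtain c' k' where s: "has_walk G w s t c' k'" "c' \<le> c" "k' \<le> k" "k' < N"
      using has_walk_short[OF G walk] unfolding N_def by metis
    have st: "(s, t) \<in> TC G" using has_walk_TC[OF G walk] .
    have hop: "hopdist G w s t < N" using hopdist_less_card[OF G st] unfolding N_def .
    have inS: "c' \<in> S" "rdist G w s t \<in> S"
      using s(1,4) hopdist_walk[OF G st] hop less_imp_le unfolding S_def by blast+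
    have "c' = rdist G w s t"
    proof (rule ccontr)
      assume "c' \<noteq> rdist G w s t"
      then have "rdist G w s t < c'" using rdist_le[OF G s(1)] by simp
      then have "c' - rdist G w s t \<in> D" using inS unfolding D_def by auto
      then have "\<delta> \<le> c' - rdist G w s t" by (rule \<delta>_le)
      moreover have "\<epsilon> * real (hopdist G w s t) \<le> \<epsilon> * real N"
        using hop \<epsilon>(1) by simp
      moreover have "0 \<le> \<epsilon> * real k" using \<epsilon>(1) by simp
      ultimately show False using le s(2) \<epsilon>(2) by linarith
    qed
    then have "hopdist G w s t \<le> k" using hopdist_le[OF G] s(1,3) by fastforce
    then have "\<epsilon> * real (hopdist G w s t) \<le> \<epsilon> * real k" using \<epsilon>(1) by simp
    with le rdist_le[OF G walk] have "c = rdist G w s t" "\<epsilon> * real (hopdist G w s t) = \<epsilon> * real k"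
      by linarith+
    with \<epsilon>(1) show ?thesis by simp
  qed
  with \<epsilon>(1) show ?thesis unfolding hop_separating_def by blast
qed

lemma has_walk_shift:
  "has_walk G (\<lambda>e. w e + \<epsilon>) s t c k \<longleftrightarrow> has_walk G w s t (c - \<epsilon> * real k) k"
proof -
  have "sum_list (map (\<lambda>e. w e + \<epsilon>) p) = sum_list (map w p) + \<epsilon> * real (length p)" for p
    by (induction p) (auto simp: algebra_simps)
  then show ?thesis unfolding has_walk_def by (auto simp: algebra_simps)
qed

context
  fixes G :: "'a pair_pre_digraph" and w \<epsilon>
  assumes G: "weighted_graph G w" and sep: "hop_separating G w \<epsilon>"
begin

lemma hop_separatingD:
  assumes "has_walk G w s t c k"
    "c + \<epsilon> * real k \<le> rdist G w s t + \<epsilon> * real (hopdist G w s t)"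
  shows "c = rdist G w s t" "k = hopdist G w s t"
  using sep assms unfolding hop_separating_def by blast+

lemma weighted_graph_shift: "weighted_graph G (\<lambda>e. w e + \<epsilon>)"
  using G sep unfolding weighted_graph_def hop_separating_def by fastforce

text \<open>The perturbed distance encodes the lexicographic minimum of cost and arc count.\<close>

lemma rdist_shift:
  assumes "(s, t) \<in> TC G"
  shows "rdist G (\<lambda>e. w e + \<epsilon>) s t = rdist G w s t + \<epsilon> * real (hopdist G w s t)"
proof (rule antisym)
  have "has_walk G (\<lambda>e. w e + \<epsilon>) s t (rdist G w s t + \<epsilon> * real (hopdist G w s t)) (hopdist G w s t)"
    using hopdist_walk[OF G assms] by (simp add: has_walk_shift)
  then show "rdist G (\<lambda>e. w e + \<epsilon>) s t \<le> rdist G w s t + \<epsilon> * real (hopdist G w s t)"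
    by (rule rdist_le[OF weighted_graph_shift])
  obtain k where k: "has_walk G w s t (rdist G (\<lambda>e. w e + \<epsilon>) s t - \<epsilon> * real k) k"
    using rdist_walk[OF weighted_graph_shift assms] by (auto simp: has_walk_shift)
  show "rdist G w s t + \<epsilon> * real (hopdist G w s t) \<le> rdist G (\<lambda>e. w e + \<epsilon>) s t"
  proof (rule ccontr)
    \<comment> \<open>A cheaper walk would meet the premise of \<open>hop_separating\<close>, which
      forces its cost and arc count to be the distance and hop distance, so it is not
      cheaper.\<close>
    assume "\<not> ?thesis"
    then show False using hop_separatingD[OF k] by simp
  qed
qed

text \<open>Concatenating fewest-arc shortest walks attains the perturbed distance, and separation
  splits the single equation into one for costs and one for arc counts.\<close>

lemma shift_additive:
  assumes "(s, u) \<in> TC G" "(u, t) \<in> TC G"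
    and "rdist G (\<lambda>e. w e + \<epsilon>) s t = rdist G (\<lambda>e. w e + \<epsilon>) s u + rdist G (\<lambda>e. w e + \<epsilon>) u t"
  shows "rdist G w s t = rdist G w s u + rdist G w u t"
    "hopdist G w s t = hopdist G w s u + hopdist G w u t"
proof -
  have *: "has_walk G w s t (rdist G w s u + rdist G w u t) (hopdist G w s u + hopdist G w u t)"
    by (rule has_walk_append[OF G hopdist_walk[OF G assms(1)] hopdist_walk[OF G assms(2)]])
  have "rdist G w s u + rdist G w u t + \<epsilon> * real (hopdist G w s u + hopdist G w u t)
      \<le> rdist G w s t + \<epsilon> * real (hopdist G w s t)"
    using assms(3)
    unfolding rdist_shift[OF assms(1)] rdist_shift[OF assms(2)] rdist_shift[OF TC_trans[OF G assms(1,2)]]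
    by (simp add: algebra_simps)
  from hop_separatingD[OF * this] show "rdist G w s t = rdist G w s u + rdist G w u t"
    "hopdist G w s t = hopdist G w s u + hopdist G w u t" by simp_all
qed

lemma hopdist_with_singleton_le:
  assumes "e \<in> TC G" "(s, t) \<in> TC G"
  shows "hopdist_with G w {e} s t \<le> hopdist G w s t"
  using hopdist_with_antimono[OF G, of "{}" "{e}" s t] assms by (simp add: hopdist_with_def)

text \<open>The individual gains add up along a shortest walk because the perturbation makes every
  shortest walk that uses arcs of \<open>J\<close> expand to a fewest-arc shortest walk, on which each gain
  is superadditive.\<close>

lemma sum_gains_ge:
  assumes J: "J \<subseteq> TC G"
    and "has_walk (add_pairs G J) (add_weight G (\<lambda>e. w e + \<epsilon>) J) s t c k"
    and "c \<le> rdist G (\<lambda>e. w e + \<epsilon>) s t"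
  shows "real (hopdist G w s t) - real k \<le>
    (\<Sum>e\<in>J. real (hopdist G w s t) - real (hopdist_with G w {e} s t))"
proof -
  let ?w = "\<lambda>e. w e + \<epsilon>"
  let ?g = "\<lambda>s t e. real (hopdist G w s t) - real (hopdist_with G w {e} s t)"
  note G' = weighted_graph_shift
  have g_nonneg: "0 \<le> ?g s t e" if "e \<in> J" "(s, t) \<in> TC G" for s t e
    using hopdist_with_singleton_le[of e s t] that J by auto
  have fin: "finite J" using J TC_finite[OF G] finite_subset by blast
  \<comment> \<open>The tightness premise is part of the induction claim, because each prefix ends
    at another vertex and needs its own instance.\<close>
  have "c \<le> rdist G ?w s t \<longrightarrow> real (hopdist G w s t) - real k \<le> sum (?g s t) J"
    using weighted_graph_add[OF G' J] assms(2)
  proof (induction rule: has_walk_induct)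
    case refl
    then have walk: "has_walk G w s s 0 0" by (simp add: has_walk_refl)
    then have ss: "(s, s) \<in> TC G" by (rule has_walk_TC[OF G])
    have "rdist G w s s = 0"
      using rdist_le[OF G walk] rdist_nonneg[OF G ss] by simp
    then have "hopdist G w s s = 0"
      using hopdist_le[OF G, of s s 0] walk by simp
    moreover have "0 \<le> sum (?g s s) J" using g_nonneg ss by (intro sum_nonneg) auto
    ultimately show ?case by simp
  next
    case (arc u t c k)
    have su: "(s, u) \<in> TC G" "rdist G ?w s u \<le> c"
      using has_walk_add_expand[OF G' J arc.hyps(1)] by auto
    have ut: "(u, t) \<in> TC G"
      using arc.hyps(2) J arc_in_TC[OF G] by auto
    have w_ut: "rdist G ?w u t \<le> add_weight G ?w J (u, t)"
      using arc.hyps(2) rdist_arc[OF G'] by (auto simp: add_weight_eq)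
    show ?case
    proof
      assume "c + add_weight G ?w J (u, t) \<le> rdist G ?w s t"
      \<comment> \<open>The triangle inequality bounds the left side from below by the right side,
        so every inequality in the chain is tight.\<close>
      with rdist_triangle[OF G' su(1) ut] su(2) w_ut
      have eq: "c = rdist G ?w s u" "add_weight G ?w J (u, t) = rdist G ?w u t"
        "rdist G ?w s t = rdist G ?w s u + rdist G ?w u t" by linarith+
      note add = shift_additive[OF su(1) ut eq(3)]
      \<comment> \<open>A last arc in \<open>J\<close> alone reduces the hop distance of its ends to
        at most 1; a tight last arc of \<open>G\<close> already has hop distance 1.\<close>
      have last: "real (hopdist G w u t) - 1 \<le> sum (?g u t) J"
      proof (cases "(u, t) \<in> J")
        case True
        have "?g u t (u, t) \<le> sum (?g u t) J"
          using True fin g_nonneg[OF _ ut] by (intro member_le_sum) auto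
        moreover have "hopdist_with G w {(u, t)} u t \<le> 1"
          using hopdist_with_shortcut[OF G] ut by simp
        ultimately show ?thesis by linarith
      next
        case False
        then have arc_ut: "(u, t) \<in> parcs G" using arc.hyps(2) by simp
        have "w (u, t) + \<epsilon> = rdist G w u t + \<epsilon> * real (hopdist G w u t)"
          using eq(2) False ut by (simp add: add_weight_eq rdist_shift)
        then have "hopdist G w u t = 1"
          using hop_separatingD(2)[OF has_walk_arc[OF G arc_ut]] by simp
        then show ?thesis using g_nonneg[OF _ ut] sum_nonneg[of J "?g u t"] by simp
      qed
      \<comment> \<open>The original hop distances add up exactly, whereas those after inserting
        \<open>e\<close> only obey the triangle inequality; so the gains are superadditive.\<close>
      have "sum (?g s u) J + sum (?g u t) J \<le> sum (?g s t) J"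
        unfolding sum.distrib[symmetric]
      proof (rule sum_mono)
        fix e assume "e \<in> J"
        then have "{e} \<subseteq> TC G" using J by auto
        from hopdist_with_triangle[OF G this su(1) ut add(1)]
        show "?g s u e + ?g u t e \<le> ?g s t e" unfolding add(2) by simp
      qed
      moreover have "real (hopdist G w s u) - real k \<le> sum (?g s u) J"
        using arc.IH eq(1) by simp
      ultimately show "real (hopdist G w s t) - real (Suc k) \<le> sum (?g s t) J"
        using last unfolding add(2) by simp
    qed
  qed
  with assms(3) show ?thesis by blast
qed

lemma hopset_gains:
  assumes "hopset G (\<lambda>e. w e + \<epsilon>) b J" "(s, t) \<in> TC G"
  shows "real (hopdist G w s t) - b \<le>
    (\<Sum>e\<in>J. real (hopdist G w s t) - real (hopdist_with G w {e} s t))"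
proof -
  let ?w = "\<lambda>e. w e + \<epsilon>"
  have J: "J \<subseteq> TC G" and b: "real (hopdist_with G ?w J s t) \<le> b"
    using assms unfolding hopset_def by auto
  have "has_walk (add_pairs G J) (add_weight G ?w J) s t (rdist G ?w s t) (hopdist_with G ?w J s t)"
    using hopdist_walk[OF weighted_graph_add[OF weighted_graph_shift J], of s t] assms(2)
    by (simp add: hopdist_with_def TC_add[OF weighted_graph_shift J]
        rdist_add[OF weighted_graph_shift J])
  from sum_gains_ge[OF J this] b show ?thesis by simp
qed

end

section \<open>One greedy step\<close>

text \<open>The pairs of \<open>J\<close> lie in \<open>TC G\<close>, so each competes in the greedy
  choice. \<open>0 < K\<close> is recorded because for \<open>K = 0\<close> division by zero would
  turn the factor into 1.\<close>

lemma potential_decrease: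
  assumes G: "weighted_graph G w" and H: "H \<subseteq> TC G"
    and sep: "hop_separating (add_pairs G H) (add_weight G w H) \<epsilon>"
    and J: "hopset (add_pairs G H) (\<lambda>e. add_weight G w H e + \<epsilon>) (real \<beta> / 2) J"
    and K: "card J \<le> K" and pos: "\<phi> G w \<beta> H \<noteq> 0"
  shows "0 < K \<and>
    (\<exists>e\<in>TC G. real (\<phi> G w \<beta> (insert e H)) \<le> (1 - 1 / (2 * real K)) * real (\<phi> G w \<beta> H))"
proof -
  let ?h = "hopdist_with G w H" and ?h' = "\<lambda>e. hopdist_with G w (insert e H)"
  note G' = weighted_graph_add[OF G H]
  have J_TC: "J \<subseteq> TC G" using J TC_add[OF G H] unfolding hopset_def by simp
  define B where "B = {(s, t) \<in> TC G. ?h s t \<ge> \<beta>}"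
  have B: "B \<subseteq> TC G" unfolding B_def by auto
  then have fin_B: "finite B" using TC_finite[OF G] finite_subset by blast
  have \<phi>: "\<phi> G w \<beta> H = (\<Sum>(s, t)\<in>B. ?h s t)" by (simp add: \<phi>_def B_def)
  \<comment> \<open>No pair enters \<open>B\<close>, as hop distances never increase; pairs that
    fall below \<beta> only lower the sum.\<close>
  have \<phi>_insert: "\<phi> G w \<beta> (insert e H) \<le> (\<Sum>(s, t)\<in>B. ?h' e s t)" if "e \<in> TC G" for e
    unfolding \<phi>_def
  proof (rule sum_mono2)
    show "{(s, t) \<in> TC G. \<beta> \<le> ?h' e s t} \<subseteq> B"
      using hopdist_with_antimono[OF G, of H "insert e H"] H that unfolding B_def by fastforce
  qed (use fin_B in auto)
  have gain: "real (?h s t) / 2 \<le> (\<Sum>e\<in>J. real (?h s t) - real (?h' e s t))" if "(s, t) \<in> B" for s t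
  proof -
    have st: "(s, t) \<in> TC (add_pairs G H)" "real \<beta> \<le> real (?h s t)"
      using that TC_add[OF G H] unfolding B_def by auto
    have "(\<Sum>e\<in>J. real (?h s t) - real (hopdist_with (add_pairs G H) (add_weight G w H) {e} s t))
        = (\<Sum>e\<in>J. real (?h s t) - real (?h' e s t))"
      by (intro sum.cong refl) (use J_TC in \<open>auto simp: hopdist_with_insert[OF G H]\<close>)
    with hopset_gains[OF G' sep J st(1)] st(2) show ?thesis
      unfolding hopdist_with_def[of G w H, symmetric] by linarith
  qed
  have "real (\<phi> G w \<beta> H) / 2 = (\<Sum>(s, t)\<in>B. real (?h s t) / 2)"
    unfolding \<phi> by (simp add: sum_divide_distrib case_prod_beta)
  also have "\<dots> \<le> (\<Sum>(s, t)\<in>B. \<Sum>e\<in>J. real (?h s t) - real (?h' e s t))"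
    using gain by (intro sum_mono) auto
  \<comment> \<open>Double counting: gains per vertex pair become gains per shortcut.\<close>
  also have "\<dots> = (\<Sum>e\<in>J. \<Sum>(s, t)\<in>B. real (?h s t) - real (?h' e s t))"
    unfolding case_prod_beta by (rule sum.swap)
  also have "\<dots> \<le> (\<Sum>e\<in>J. real (\<phi> G w \<beta> H) - real (\<phi> G w \<beta> (insert e H)))"
  proof (rule sum_mono)
    fix e assume "e \<in> J"
    then have "real (\<phi> G w \<beta> (insert e H)) \<le> real (\<Sum>(s, t)\<in>B. ?h' e s t)"
      using \<phi>_insert J_TC by (meson of_nat_mono subsetD)
    then show "(\<Sum>(s, t)\<in>B. real (?h s t) - real (?h' e s t))
        \<le> real (\<phi> G w \<beta> H) - real (\<phi> G w \<beta> (insert e H))"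
      unfolding \<phi> by (simp add: sum_subtractf case_prod_beta)
  qed
  finally have total: "real (\<phi> G w \<beta> H) / 2 \<le>
    (\<Sum>e\<in>J. real (\<phi> G w \<beta> H) - real (\<phi> G w \<beta> (insert e H)))" .
  have "J \<noteq> {}" using total pos by auto
  moreover have "finite J" using J_TC TC_finite[OF G] finite_subset by blast
  ultimately have J_pos: "0 < card J" by (simp add: card_gt_0_iff)
  then have K_pos: "0 < K" using K by simp
  have "\<exists>e\<in>J. real (\<phi> G w \<beta> H) / (2 * real K) \<le> real (\<phi> G w \<beta> H) - real (\<phi> G w \<beta> (insert e H))"
  proof (rule ccontr)
    \<comment> \<open>Averaging: at most \<open>K\<close> gains, each below \<phi> / (2 K), cannot
      reach \<phi> / 2.\<close>
    assume "\<not> ?thesis"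
    then have "(\<Sum>e\<in>J. real (\<phi> G w \<beta> H) - real (\<phi> G w \<beta> (insert e H)))
        < (\<Sum>e\<in>J. real (\<phi> G w \<beta> H) / (2 * real K))"
      using \<open>finite J\<close> \<open>J \<noteq> {}\<close> by (intro sum_strict_mono) auto
    also have "\<dots> = real (card J) * (real (\<phi> G w \<beta> H) / (2 * real K))" by simp
    also have "\<dots> \<le> real K * (real (\<phi> G w \<beta> H) / (2 * real K))"
      using K by (intro mult_right_mono) auto
    also have "\<dots> = real (\<phi> G w \<beta> H) / 2" using K_pos by simp
    finally show False using total by simp
  qed
  then show ?thesis using K_pos J_TC by (auto simp: algebra_simps)
qed

section \<open>Existential optimum\<close>

text \<open>\<open>exopt\<close> ranges over graphs on \<open>nat\<close>. Homomorphisms in both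
  directions let distances and hop distances be compared both ways.\<close>

lemma weighted_graph_nat_copy:
  fixes G :: "'a pair_pre_digraph"
  assumes G: "weighted_graph G w"
  obtains G' :: "nat pair_pre_digraph" and w' f g where
    "weighted_graph G' w'" "card (pverts G') = card (pverts G)" "card (parcs G') = card (parcs G)"
    "weighted_hom G w G' w' f" "weighted_hom G' w' G w g" "\<And>v. v \<in> pverts G \<Longrightarrow> g (f v) = v"
    "\<And>v. v \<in> pverts G' \<Longrightarrow> f (g v) = v"
proof -
  obtain f :: "'a \<Rightarrow> nat" where f: "inj_on f (pverts G)"
    using finite_imp_inj_to_nat_seg[OF weighted_graph_finite(1)[OF G]] by blast
  define g where "g = inv_into (pverts G) f"
  have g: "g (f v) = v" if "v \<in> pverts G" for v using f that unfolding g_def by simp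
  define G' where "G' = \<lparr>pverts = f ` pverts G, parcs = map_prod f f ` parcs G\<rparr>"
  define w' where "w' = w \<circ> map_prod g g"
  note arc = weighted_graph_arc[OF G]
  show thesis
  proof
    show "weighted_graph G' w'"
      using weighted_graph_finite(1)[OF G] arc
      by (intro weighted_graphI) (auto simp: G'_def w'_def g)
    have "inj_on (map_prod f f) (parcs G)"
      by (rule inj_on_subset[OF map_prod_inj_on[OF f f]]) (use arc in auto)
    then show "card (parcs G') = card (parcs G)" by (simp add: G'_def card_image)
    show "card (pverts G') = card (pverts G)" using f by (simp add: G'_def card_image)
    show "weighted_hom G w G' w' f"
      using arc by (auto simp: weighted_hom_def G'_def w'_def g)
    show "weighted_hom G' w' G w g"
      using arc by (auto simp: weighted_hom_def G'_def w'_def g)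
  qed (auto simp: g G'_def)
qed

text \<open>The renaming preserves distances exactly, so shortcut weights agree and \<open>g\<close>
  remains a homomorphism after the shortcuts are added.\<close>

lemma hopset_image:
  assumes G: "weighted_graph G w" and G': "weighted_graph G' w'"
    and f: "weighted_hom G w G' w' f" and g: "weighted_hom G' w' G w g"
    and gf: "\<And>v. v \<in> pverts G \<Longrightarrow> g (f v) = v" and fg: "\<And>v. v \<in> pverts G' \<Longrightarrow> f (g v) = v"
    and J: "hopset G' w' b J"
  shows "hopset G w b (map_prod g g ` J)"
proof -
  let ?J = "map_prod g g ` J"
  have J_TC: "J \<subseteq> TC G'" and b: "\<And>s t. (s, t) \<in> TC G' \<Longrightarrow> real (hopdist_with G' w' J s t) \<le> b"
    using J unfolding hopset_def by auto
  have gJ_TC: "?J \<subseteq> TC G" using J_TC TC_hom[OF G' G g] by auto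
  have dist_g: "rdist G w (g u) (g v) = rdist G' w' u v" if "(u, v) \<in> TC G'" for u v
  proof (rule antisym)
    have "f (g u) = u" "f (g v) = v" using TC_verts[OF G'] that fg by auto
    then show "rdist G' w' u v \<le> rdist G w (g u) (g v)"
      using rdist_hom[OF G G' f TC_hom[OF G' G g that]] by simp
  qed (rule rdist_hom[OF G' G g that])
  have hom: "weighted_hom (add_pairs G' J) (add_weight G' w' J) (add_pairs G ?J) (add_weight G w ?J) g"
    unfolding weighted_hom_def
  proof (intro conjI allI impI)
    show "g ` pverts (add_pairs G' J) \<subseteq> pverts (add_pairs G ?J)"
      using g by (simp add: weighted_hom_def)
    fix u v assume uv: "(u, v) \<in> parcs (add_pairs G' J)"
    then show "(g u, g v) \<in> parcs (add_pairs G ?J)"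
      using g by (auto simp: weighted_hom_def)
    have "(u, v) \<in> TC G'" using uv J_TC arc_in_TC[OF G'] by auto
    then have "rdist G w (g u) (g v) \<le> add_weight G' w' J (u, v)"
      using dist_g uv rdist_arc[OF G'] by (auto simp: add_weight_eq)
    moreover have "w (g u, g v) \<le> w' (u, v)" if "(u, v) \<notin> J"
      using that uv g by (auto simp: weighted_hom_def)
    moreover have "(g u, g v) \<in> ?J" if "(u, v) \<in> J" using that by auto
    ultimately show "add_weight G w ?J (g u, g v) \<le> add_weight G' w' J (u, v)"
      by (auto simp: add_weight_eq)
  qed
  have "real (hopdist_with G w ?J s t) \<le> b" if st: "(s, t) \<in> TC G" for s t
  proof -
    have st': "(f s, f t) \<in> TC G'" by (rule TC_hom[OF G G' f st])
    have inv: "g (f s) = s" "g (f t) = t" using TC_verts[OF G] st gf by auto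
    have "hopdist_with G w ?J (g (f s)) (g (f t)) \<le> hopdist_with G' w' J (f s) (f t)"
      unfolding hopdist_with_def
    proof (rule hopdist_hom[OF weighted_graph_add[OF G' J_TC] weighted_graph_add[OF G gJ_TC] hom])
      show "(f s, f t) \<in> TC (add_pairs G' J)" using st' TC_add[OF G' J_TC] by simp
      show "rdist (add_pairs G ?J) (add_weight G w ?J) (g (f s)) (g (f t)) =
          rdist (add_pairs G' J) (add_weight G' w' J) (f s) (f t)"
        using dist_g[OF st'] st st' inv by (simp add: rdist_add[OF G gJ_TC] rdist_add[OF G' J_TC])
    qed
    then show ?thesis using b[OF st'] inv by simp
  qed
  then show ?thesis using gJ_TC unfolding hopset_def by auto
qed

lemma exopt_hopset:
  fixes G :: "'a pair_pre_digraph"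
  assumes k: "exopt n m b = enat k" and G: "weighted_graph G w"
    and n: "card (pverts G) \<le> n" and m: "real (card (parcs G)) \<le> m"
  shows "\<exists>J. hopset G w b J \<and> card J \<le> k"
proof -
  obtain G' :: "nat pair_pre_digraph" and w' f g where copy:
    "weighted_graph G' w'" "card (pverts G') = card (pverts G)" "card (parcs G') = card (parcs G)"
    "weighted_hom G w G' w' f" "weighted_hom G' w' G w g" "\<And>v. v \<in> pverts G \<Longrightarrow> g (f v) = v"
    "\<And>v. v \<in> pverts G' \<Longrightarrow> f (g v) = v"
    by (rule weighted_graph_nat_copy[OF G]) (rule that)
  define S where "S = {enat k | k. \<forall>(G :: nat pair_pre_digraph) w.
     weighted_graph G w \<and> card (pverts G) \<le> n \<and> real (card (parcs G)) \<le> m \<longrightarrow>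
     (\<exists>H. hopset G w b H \<and> card H \<le> k)}"
  have "Inf S = enat k" using k by (simp add: exopt_def S_def)
  \<comment> \<open>A finite infimum rules out the empty set, and in \<open>enat\<close> the infimum
    of a nonempty set is its least element.\<close>
  then have "enat k \<in> S"
    using LeastI_ex[of "\<lambda>x. x \<in> S"] by (auto simp: Inf_enat_def split: if_splits)
  then have "\<exists>J. hopset G' w' b J \<and> card J \<le> k"
    using copy(1-3) n m unfolding S_def by simp
  then obtain J where J: "hopset G' w' b J" "card J \<le> k" by blast
  \<comment> \<open>Needed for the image bound, as infinite sets have \<open>card\<close> 0.\<close>
  have "finite J"
    using J(1) TC_finite[OF copy(1)] finite_subset unfolding hopset_def by blast
  then have "card (map_prod g g ` J) \<le> k"
    using J(2) card_image_le order_trans by blast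
  then show ?thesis using hopset_image[OF G copy(1,4-7) J(1)] by blast
qed

text \<open>A larger arc budget admits more graphs, so fewer values of \<open>k\<close> serve them
  all.\<close>

lemma exopt_mono:
  assumes "m \<le> m'"
  shows "exopt n m b \<le> exopt n m' b"
proof -
  have "real c \<le> m'" if "real c \<le> m" for c using that assms by linarith
  then show ?thesis
    unfolding exopt_def by (intro Inf_superset_mono Collect_mono impI)
      (elim ex_forward conj_forward, simp_all)
qed

section \<open>Greedy runs\<close>

lemma potential_empty_le:
  assumes "weighted_graph G w"
  shows "\<phi> G w \<beta> {} \<le> card (pverts G) ^ 3"
proof -
  let ?n = "card (pverts G)"
  have "\<phi> G w \<beta> {} \<le> (\<Sum>(s, t)\<in>TC G. hopdist_with G w {} s t)"
    unfolding \<phi>_def by (rule sum_mono2) (use TC_finite[OF assms] in auto)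
  also have "\<dots> \<le> (\<Sum>e\<in>TC G. ?n)"
    using hopdist_with_le_card[OF assms, of "{}"] by (intro sum_mono) auto
  also have "\<dots> = card (TC G) * ?n" by simp
  also have "card (TC G) \<le> card (pverts G \<times> pverts G)"
    using TC_verts[OF assms] weighted_graph_finite(1)[OF assms] by (intro card_mono) auto
  finally show ?thesis by (simp add: card_cartesian_product power3_eq_cube)
qed

lemma greedy_run_subset:
  assumes "R 0 = {}" "\<And>i. i < N \<Longrightarrow> greedy_step G w \<beta> (R i) (R (Suc i))" "i \<le> N"
  shows "R i \<subseteq> TC G \<and> finite (R i) \<and> card (R i) \<le> i"
  using assms(3)
proof (induction i)
  case 0
  then show ?case using assms(1) by simp
next
  case (Suc i)
  then obtain p where p: "p \<in> TC G" "R (Suc i) = insert p (R i)"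
    using assms(2)[of i] unfolding greedy_step_def by auto
  then show ?case using Suc card_insert_le_m1[of "Suc i" "R i" p] by (auto intro: order_trans[OF card_insert_le_m1])
qed

text \<open>The hopset premise covers all graphs on the same vertices, because the current graph and
  its perturbation change at every step. The budget \<open>M\<close> leaves room for
  \<open>L\<close> new arcs.\<close>

lemma greedy_run_length:
  fixes G :: "'a pair_pre_digraph"
  assumes G: "weighted_graph G w"
    and hopsets: "\<And>(G' :: 'a pair_pre_digraph) w'. weighted_graph G' w' \<Longrightarrow> pverts G' = pverts G \<Longrightarrow>
      real (card (parcs G')) \<le> M \<Longrightarrow> \<exists>J. hopset G' w' (real \<beta> / 2) J \<and> card J \<le> K"
    and L: "L = 6 * real K * ln (real (card (pverts G))) + 1"
    and M: "real (card (parcs G)) + L \<le> M"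
    and R0: "R 0 = {}" and steps: "\<And>i. i < N \<Longrightarrow> greedy_step G w \<beta> (R i) (R (Suc i))"
  shows "real N \<le> L"
proof (rule ccontr)
  assume "\<not> real N \<le> L"
  then have N: "L < real N" by simp
  let ?n = "card (pverts G)"
  note run = greedy_run_subset[of R N G w \<beta>, OF R0 steps]
  \<comment> \<open>Up to index \<open>L\<close> at most \<open>L\<close> pairs were added, so the
    arc budget \<open>M\<close> still holds.\<close>
  have decr: "0 < K \<and> real (\<phi> G w \<beta> (R (Suc i))) \<le> (1 - 1 / (2 * real K)) * real (\<phi> G w \<beta> (R i))"
    if i: "i < N" "real i \<le> L" for i
  proof -
    let ?G = "add_pairs G (R i)" and ?w = "add_weight G w (R i)"
    have R: "R i \<subseteq> TC G" "finite (R i)" "card (R i) \<le> i" using run[of i] i(1) by auto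
    note G' = weighted_graph_add[OF G R(1)]
    obtain \<epsilon> where \<epsilon>: "hop_separating ?G ?w \<epsilon>" using hop_separating_exists[OF G'] by blast
    have "card (parcs ?G) \<le> card (parcs G) + i"
      using card_Un_le[of "parcs G" "R i"] R(3) by simp
    then have "real (card (parcs ?G)) \<le> real (card (parcs G)) + real i"
      by (metis of_nat_add of_nat_mono)
    then have "real (card (parcs ?G)) \<le> M" using M i(2) by linarith
    then obtain J where J: "hopset ?G (\<lambda>e. ?w e + \<epsilon>) (real \<beta> / 2) J" "card J \<le> K"
      using hopsets[OF weighted_graph_shift[OF G' \<epsilon>]] by auto
    obtain p where p: "\<phi> G w \<beta> (R i) \<noteq> 0" "R (Suc i) = insert p (R i)"
        "\<And>q. q \<in> TC G \<Longrightarrow> \<phi> G w \<beta> (R (Suc i)) \<le> \<phi> G w \<beta> (insert q (R i))"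
      using steps[OF i(1)] unfolding greedy_step_def by auto
    obtain e where "0 < K" "e \<in> TC G"
        "real (\<phi> G w \<beta> (insert e (R i))) \<le> (1 - 1 / (2 * real K)) * real (\<phi> G w \<beta> (R i))"
      using potential_decrease[OF G R(1) \<epsilon> J p(1)] by blast
    with p(3)[of e] show ?thesis by simp
  qed
  have nz: "\<phi> G w \<beta> (R i) \<noteq> 0" if "i < N" for i
    using steps[OF that] unfolding greedy_step_def by simp
  have n: "0 < ?n"
  proof (rule ccontr)
    \<comment> \<open>Without vertices the potential is 0 from the start, and
      \<open>ln 0 = 0\<close> gives \<open>L = 1\<close>, yet a first step is assumed.\<close>
    assume "\<not> 0 < ?n"
    then have "\<phi> G w \<beta> {} = 0" "L = 1" using potential_empty_le[OF G, of \<beta>] L by auto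
    then show False using nz[of 0] N R0 by simp
  qed
  then have ln_n: "0 \<le> ln (real ?n)" by simp
  then have L1: "1 \<le> L" unfolding L by simp
  have K: "0 < K" using decr[of 0] L1 N by simp
  have decay: "real (\<phi> G w \<beta> (R i)) \<le> real ?n ^ 3 * exp (- (real i / (2 * real K)))"
    if "i < N" "real i \<le> L" for i
    using that
  proof (induction i)
    case 0
    then show ?case using potential_empty_le[OF G, of \<beta>] R0 by (simp flip: of_nat_power)
  next
    case (Suc i)
    have "real (\<phi> G w \<beta> (R (Suc i))) \<le> (1 - 1 / (2 * real K)) * real (\<phi> G w \<beta> (R i))"
      using decr[of i] Suc.prems by simp
    \<comment> \<open>Uses \<open>1 - y \<le> exp (- y)\<close>.\<close>
    also have "\<dots> \<le> exp (- (1 / (2 * real K))) * real (\<phi> G w \<beta> (R i))"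
      using exp_ge_add_one_self[of "- (1 / (2 * real K))"] by (intro mult_right_mono) auto
    also have "\<dots> \<le> exp (- (1 / (2 * real K))) * (real ?n ^ 3 * exp (- (real i / (2 * real K))))"
      using Suc by (intro mult_left_mono) auto
    also have "\<dots> = real ?n ^ 3 * exp (- (real (Suc i) / (2 * real K)))"
      by (simp add: exp_add[symmetric] add_divide_distrib)
    finally show ?case .
  qed
  \<comment> \<open>The last index within the budget. The summand 1 in \<open>L\<close> absorbs the
    rounding: \<open>i > 6 * K * ln n\<close>, which pushes the potential below 1.\<close>
  define i where "i = nat \<lfloor>L\<rfloor>"
  have i: "real i \<le> L" "L < real i + 1" using L1 unfolding i_def by linarith+
  then have "i < N" using N by linarith
  have "3 * ln (real ?n) < real i / (2 * real K)"
    using i(2) K unfolding L by (simp add: field_simps)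
  then have "exp (3 * ln (real ?n)) < exp (real i / (2 * real K))" by simp
  moreover have "exp (3 * ln (real ?n)) = real ?n ^ 3"
    using n by (simp add: exp_of_nat_mult[of 3, simplified])
  ultimately have "real ?n ^ 3 * exp (- (real i / (2 * real K))) < 1"
    by (simp add: exp_minus field_simps)
  then have "real (\<phi> G w \<beta> (R i)) < 1" using decay[OF \<open>i < N\<close> i(1)] by linarith
  then show False using nz[OF \<open>i < N\<close>] by simp
qed

section \<open>Vanishing potential and hop bounds\<close>

lemma hopset_if_potential_eq_0:
  assumes "weighted_graph G w" "H \<subseteq> TC G" "\<phi> G w \<beta> H = 0"
  shows "hopset G w (real \<beta>) H"
proof -
  have "hopdist_with G w H s t \<le> \<beta>" if "(s, t) \<in> TC G" for s t
  proof (rule ccontr)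
    assume *: "\<not> hopdist_with G w H s t \<le> \<beta>"
    have "finite {(s, t) \<in> TC G. hopdist_with G w H s t \<ge> \<beta>}"
      using TC_finite[OF assms(1)] by (auto intro: finite_subset)
    \<comment> \<open>A vanishing sum of naturals has only zero terms, whereas a hop distance above
      \<beta> is positive.\<close>
    with assms(3) have "\<forall>(s, t)\<in>{(s, t) \<in> TC G. hopdist_with G w H s t \<ge> \<beta>}. hopdist_with G w H s t = 0"
      unfolding \<phi>_def by (simp add: case_prod_beta)
    moreover have "(s, t) \<in> {(s, t) \<in> TC G. hopdist_with G w H s t \<ge> \<beta>}" using * that by simp
    ultimately have "hopdist_with G w H s t = 0" by blast
    then show False using * by simp
  qed
  then show ?thesis using assms(2) unfolding hopset_def by auto
qed

text \<open>A hop distance that is at least \<beta> but at most \<beta> / 2 is 0. This settles the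
  case of optimum 0, where the loop is never entered.\<close>

lemma potential_eq_0_if_empty_hopset:
  assumes "hopset G w (real \<beta> / 2) {}"
  shows "\<phi> G w \<beta> {} = 0"
proof -
  have "hopdist_with G w {} s t = 0" if "(s, t) \<in> TC G" "\<beta> \<le> hopdist_with G w {} s t" for s t
  proof -
    have "real (hopdist_with G w {} s t) \<le> real \<beta> / 2"
      using assms that(1) unfolding hopset_def by auto
    then show ?thesis using that(2) by linarith
  qed
  then show ?thesis unfolding \<phi>_def by (auto intro!: sum.neutral)
qed

section \<open>Subpolynomial functions\<close>

text \<open>The exponent is recovered as a quotient of logarithms, where eventual positivity makes
  \<open>ln\<close> faithful; this form handles sums.\<close>

lemma n_pow_o1_iff:
  "n_pow_o1 f \<longleftrightarrow> (\<forall>\<^sub>F n in sequentially. 0 < f n) \<and> (\<lambda>n. ln (f n) / ln (real n)) \<longlonglongrightarrow> 0"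
proof
  assume "n_pow_o1 f"
  then obtain e where e: "e \<longlonglongrightarrow> 0" "\<forall>\<^sub>F n in sequentially. f n = real n powr e n"
    unfolding n_pow_o1_def by blast
  have "\<forall>\<^sub>F n in sequentially. 0 < f n"
    using e(2) eventually_gt_at_top[of 1] by eventually_elim simp
  moreover have "\<forall>\<^sub>F n in sequentially. e n = ln (f n) / ln (real n)"
    using e(2) eventually_gt_at_top[of 1] by eventually_elim (simp add: ln_powr)
  ultimately show "(\<forall>\<^sub>F n in sequentially. 0 < f n) \<and> (\<lambda>n. ln (f n) / ln (real n)) \<longlonglongrightarrow> 0"
    by (intro conjI Lim_transform_eventually[OF e(1)])
next
  assume *: "(\<forall>\<^sub>F n in sequentially. 0 < f n) \<and> (\<lambda>n. ln (f n) / ln (real n)) \<longlonglongrightarrow> 0"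
  then have "\<forall>\<^sub>F n in sequentially. 0 < f n" by blast
  then have "\<forall>\<^sub>F n in sequentially. f n = real n powr (ln (f n) / ln (real n))"
    using eventually_gt_at_top[of 1] by eventually_elim (simp add: powr_def)
  with * show "n_pow_o1 f"
    unfolding n_pow_o1_def by (intro exI[of _ "\<lambda>n. ln (f n) / ln (real n)"]) simp
qed

lemma n_pow_o1_const: "0 < c \<Longrightarrow> n_pow_o1 (\<lambda>_. c)"
  unfolding n_pow_o1_iff by (intro conjI) (simp, real_asymp)

lemma n_pow_o1_ln: "n_pow_o1 (\<lambda>n. ln (real n))"
  unfolding n_pow_o1_iff by (intro conjI; real_asymp)

text \<open>Absolute values keep the final bounds monotone for every \<open>n\<close>, including
  small ones where the given functions may be negative.\<close>

lemma n_pow_o1_abs: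
  assumes "n_pow_o1 f"
  shows "n_pow_o1 (\<lambda>n. \<bar>f n\<bar>)"
proof -
  obtain e where e: "e \<longlonglongrightarrow> 0" "\<forall>\<^sub>F n in sequentially. f n = real n powr e n"
    using assms unfolding n_pow_o1_def by blast
  have "\<forall>\<^sub>F n in sequentially. \<bar>f n\<bar> = real n powr e n" using e(2) by eventually_elim simp
  with e(1) show ?thesis unfolding n_pow_o1_def by blast
qed

lemma n_pow_o1_mult:
  assumes "n_pow_o1 f" "n_pow_o1 g"
  shows "n_pow_o1 (\<lambda>n. f n * g n)"
proof -
  obtain d where d: "d \<longlonglongrightarrow> 0" "\<forall>\<^sub>F n in sequentially. f n = real n powr d n"
    using assms(1) unfolding n_pow_o1_def by blast
  obtain e where e: "e \<longlonglongrightarrow> 0" "\<forall>\<^sub>F n in sequentially. g n = real n powr e n"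
    using assms(2) unfolding n_pow_o1_def by blast
  have "\<forall>\<^sub>F n in sequentially. f n * g n = real n powr (d n + e n)"
    using d(2) e(2) by eventually_elim (simp add: powr_add)
  moreover have "(\<lambda>n. d n + e n) \<longlonglongrightarrow> 0" using tendsto_add[OF d(1) e(1)] by simp
  ultimately show ?thesis unfolding n_pow_o1_def by blast
qed

text \<open>The sum lies between \<open>f\<close> and twice the maximum of \<open>f\<close> and
  \<open>g\<close>, and the factor 2 contributes only \<open>ln 2 / ln n\<close> to the
  exponent.\<close>

lemma n_pow_o1_add:
  assumes "n_pow_o1 f" "n_pow_o1 g"
  shows "n_pow_o1 (\<lambda>n. f n + g n)"
proof -
  let ?l = "\<lambda>f n. ln (f n) / ln (real n)"
  have f: "\<forall>\<^sub>F n in sequentially. 0 < f n" "?l f \<longlonglongrightarrow> 0"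
    and g: "\<forall>\<^sub>F n in sequentially. 0 < g n" "?l g \<longlonglongrightarrow> 0"
    using assms unfolding n_pow_o1_iff by auto
  have "?l (\<lambda>n. f n + g n) \<longlonglongrightarrow> 0"
  proof (rule tendsto_sandwich)
    show "\<forall>\<^sub>F n in sequentially. ?l f n \<le> ?l (\<lambda>n. f n + g n) n"
      using f(1) g(1) eventually_gt_at_top[of 1]
      by eventually_elim (simp add: divide_right_mono)
    show "\<forall>\<^sub>F n in sequentially. ?l (\<lambda>n. f n + g n) n \<le> ln 2 / ln (real n) + max (?l f n) (?l g n)"
      using f(1) g(1) eventually_gt_at_top[of 1]
    proof eventually_elim
      case (elim n)
      have "ln (f n + g n) \<le> ln (2 * max (f n) (g n))"
        using elim by (subst ln_le_cancel_iff) auto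
      also have "\<dots> = ln 2 + max (ln (f n)) (ln (g n))"
        using elim by (subst ln_mult) (auto simp: max_def)
      finally have "ln (f n + g n) / ln (real n) \<le> (ln 2 + max (ln (f n)) (ln (g n))) / ln (real n)"
        using elim by (intro divide_right_mono) auto
      also have "\<dots> = ln 2 / ln (real n) + max (?l f n) (?l g n)"
        using elim by (simp add: add_divide_distrib max_divide_distrib_right)
      finally show ?case .
    qed
    have "(\<lambda>n. ln 2 / ln (real n)) \<longlonglongrightarrow> 0" by real_asymp
    from tendsto_add[OF this tendsto_max[OF f(2) g(2)]]
    show "(\<lambda>n. ln 2 / ln (real n) + max (?l f n) (?l g n)) \<longlonglongrightarrow> 0" by simp
  qed (rule f(2))
  moreover have "\<forall>\<^sub>F n in sequentially. 0 < f n + g n"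
    using f(1) g(1) by eventually_elim simp
  ultimately show ?thesis unfolding n_pow_o1_iff by blast
qed

section \<open>The greedy hopset\<close>

lemma greedy_run_bound:
  fixes G :: "'a pair_pre_digraph" and f C x
  defines "n \<equiv> card (pverts G)" and "m \<equiv> card (parcs G)"
  assumes G: "weighted_graph G w"
    and opt: "ereal_of_enat (exopt n (real m) (real \<beta> / 2)) \<le> ereal (real m * f)"
    and C: "2 + 6 * \<bar>f\<bar> * ln (real n) \<le> C" and Cx: "1 \<le> C * x"
    and crit: "critical C x n (real m) (real \<beta> / 2)"
    and R0: "R 0 = {}" and steps: "\<And>i. i < N \<Longrightarrow> greedy_step G w \<beta> (R i) (R (Suc i))"
  shows "real N \<le> real m * (1 + 6 * \<bar>f\<bar> * \<bar>x\<bar> * ln (real n))"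
proof (cases "N = 0")
  case True
  have "0 \<le> ln (real n)" by (cases "n = 0") auto
  with True show ?thesis by simp
next
  case False
  obtain k where k: "exopt n (real m) (real \<beta> / 2) = enat k"
    using opt by (cases "exopt n (real m) (real \<beta> / 2)") auto
  have kf: "real k \<le> real m * f" using opt by (simp add: k)
  \<comment> \<open>With \<open>k = 0\<close> the empty set would be a hopset, so no greedy step
    could occur.\<close>
  have k_pos: "0 < k"
  proof (rule ccontr)
    assume "\<not> 0 < k"
    then obtain J where J: "hopset G w (real \<beta> / 2) J" "card J = 0"
      using exopt_hopset[OF k G] unfolding n_def m_def by auto
    then have "J = {}"
      using TC_finite[OF G] finite_subset unfolding hopset_def by fastforce
    then have "\<phi> G w \<beta> {} = 0" using J potential_eq_0_if_empty_hopset by blast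
    then show False using steps[of 0] False R0 unfolding greedy_step_def by simp
  qed
  have m_pos: "1 \<le> real m" using kf k_pos by (cases "m = 0") auto
  then have "parcs G \<noteq> {}" by (auto simp: m_def)
  then have "pverts G \<noteq> {}" using weighted_graph_arc(1)[OF G] by fast
  then have n_pos: "0 < n"
    using weighted_graph_finite(1)[OF G] unfolding n_def by (simp add: card_gt_0_iff)
  then have ln_n: "0 \<le> ln (real n)" by simp
  let ?M = "real m * (C * x)"
  have crit': "ereal_of_enat (exopt n ?M (real \<beta> / 2)) \<le> ereal (real k * x)"
    using crit unfolding critical_def k by simp
  then obtain l where l: "exopt n ?M (real \<beta> / 2) = enat l"
    by (cases "exopt n ?M (real \<beta> / 2)") auto
  have lx: "real l \<le> real k * x" using crit' by (simp add: l)
  \<comment> \<open>Because \<open>1 \<le> C * x\<close>, the enlarged budget is at least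
    \<open>m\<close>; monotonicity and criticality then give \<open>1 \<le> x\<close>.\<close>
  have "k \<le> l"
    using exopt_mono[of "real m" ?M n "real \<beta> / 2"] Cx m_pos unfolding k l by simp
  then have "real k \<le> real k * x" using lx by linarith
  then have x: "1 \<le> x" using k_pos by simp
  have "real k * x \<le> (real m * f) * x" using kf x by (intro mult_right_mono) auto
  also have "\<dots> \<le> (real m * \<bar>f\<bar>) * x" using x by (intro mult_right_mono mult_left_mono) auto
  finally have l_le: "real l \<le> real m * \<bar>f\<bar> * x" using lx by linarith
  define L where "L = 6 * real l * ln (real n) + 1"
  have "6 * real l * ln (real n) \<le> 6 * (real m * \<bar>f\<bar> * x) * ln (real n)"
    using l_le ln_n by (intro mult_right_mono) auto
  then have L: "L \<le> real m * (1 + 6 * \<bar>f\<bar> * x * ln (real n))"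
    using m_pos unfolding L_def by (simp add: algebra_simps)
  have "real N \<le> L"
  proof (rule greedy_run_length[OF G, where M = ?M and K = l and R = R])
    show "\<exists>J. hopset G' w' (real \<beta> / 2) J \<and> card J \<le> l"
      if "weighted_graph G' w'" "pverts G' = pverts G" "real (card (parcs G')) \<le> ?M"
      for G' :: "'a pair_pre_digraph" and w'
      using exopt_hopset[OF l that(1) _ that(3)] that(2) unfolding n_def by simp
    \<comment> \<open>The 2 in the bound on \<open>C\<close> pays for the \<open>m\<close> original
      arcs and for the summand 1 in \<open>L\<close>; the logarithmic term pays for the remaining
      steps.\<close>
    have "real m * ((2 + 6 * \<bar>f\<bar> * ln (real n)) * x) \<le> ?M"
      using C x by (intro mult_left_mono mult_right_mono) auto
    moreover have "real m * 2 \<le> real m * (2 * x)" using x by (intro mult_left_mono) auto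
    ultimately show "real (card (parcs G)) + L \<le> ?M"
      using L unfolding m_def[symmetric] by (simp add: algebra_simps)
  qed (use R0 steps in \<open>auto simp: L_def n_def\<close>)
  with L x show ?thesis by simp
qed

text \<open>To make the asymptotics uniform, \<open>C\<^sub>0\<close> depends only on
  \<open>f\<close>, and \<open>g\<close> is chosen before the graph. \<open>C\<close> and
  \<open>x\<close> may vary with the graph between the given bounds, and
  \<open>1 \<le> C * x\<close> keeps the enlarged budget from falling below
  \<open>m\<close>.\<close>

theorem theorem5p1:
  fixes f :: "nat \<Rightarrow> real"
  assumes "n_pow_o1 f"
  shows "\<exists>C\<^sub>0. n_pow_o1 C\<^sub>0 \<and>
    (\<forall>C\<^sub>1 X. n_pow_o1 C\<^sub>1 \<longrightarrow> n_pow_o1 X \<longrightarrow>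
      (\<exists>g. n_pow_o1 g \<and>
        (\<forall>(G :: 'a pair_pre_digraph) w n m \<beta>.
          weighted_graph G w \<longrightarrow> card (pverts G) = n \<longrightarrow> card (parcs G) = m \<longrightarrow>
          ereal_of_enat (exopt n (real m) (real \<beta> / 2)) \<le> ereal (real m * f n) \<longrightarrow>
          (\<exists>C x. C\<^sub>0 n \<le> C \<and> C \<le> C\<^sub>1 n \<and> 1 \<le> C * x \<and> x \<le> X n \<and>
             critical C x n (real m) (real \<beta> / 2)) \<longrightarrow>
          greedy_terminates G w \<beta> \<and>
          (\<forall>H. greedy_output G w \<beta> H \<longrightarrow>
             hopset G w (real \<beta>) H \<and> real (card H) \<le> real m * g n))))"
proof -
  let ?C\<^sub>0 = "\<lambda>n. 2 + 6 * \<bar>f n\<bar> * ln (real n)"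
  let ?g = "\<lambda>a n. 1 + 6 * \<bar>f n\<bar> * \<bar>a\<bar> * ln (real n)"
  \<comment> \<open>The parameter \<open>a\<close> stands for the upper bound on \<open>x\<close>
    and becomes \<open>X n\<close> at the end, so the bound no longer mentions
    \<open>x\<close>.\<close>
  have greedy: "greedy_terminates G w \<beta> \<and> (\<forall>H. greedy_output G w \<beta> H \<longrightarrow>
      hopset G w (real \<beta>) H \<and> real (card H) \<le> real m * ?g a n)"
    if G: "weighted_graph G w" and n: "card (pverts G) = n" and m: "card (parcs G) = m"
      and opt: "ereal_of_enat (exopt n (real m) (real \<beta> / 2)) \<le> ereal (real m * f n)"
      and C: "?C\<^sub>0 n \<le> C" "1 \<le> C * x" and x: "x \<le> a"
      and crit: "critical C x n (real m) (real \<beta> / 2)"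
    for a and G :: "'a pair_pre_digraph" and w n m \<beta> C x
  proof -
    have ln_n: "0 \<le> ln (real n)" by (cases "n = 0") auto
    have "0 \<le> 6 * \<bar>f n\<bar> * ln (real n)" using ln_n by simp
    then have "0 < C" using C(1) by linarith
    \<comment> \<open>Positivity turns \<open>x \<le> a\<close> into the comparison of absolute
      values used below.\<close>
    then have x_pos: "0 < x" using C(2) by (smt (verit) mult_nonneg_nonpos)
    have bound: "real N \<le> real m * ?g a n"
      if "R 0 = {}" "\<And>i. i < N \<Longrightarrow> greedy_step G w \<beta> (R i) (R (Suc i))" for R N
    proof -
      have "real N \<le> real m * (1 + 6 * \<bar>f n\<bar> * \<bar>x\<bar> * ln (real n))"
        using greedy_run_bound[OF G, of \<beta> "f n" C x R N] opt C crit that n m by simp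
      also have "\<dots> \<le> real m * ?g a n"
        using x x_pos ln_n by (intro mult_left_mono mult_right_mono add_left_mono) auto
      finally show ?thesis .
    qed
    have "greedy_terminates G w \<beta>"
      unfolding greedy_terminates_def
    proof
      assume "\<exists>R. R 0 = {} \<and> (\<forall>i :: nat. greedy_step G w \<beta> (R i) (R (Suc i)))"
      then obtain R where R: "R 0 = {}" "\<And>i :: nat. greedy_step G w \<beta> (R i) (R (Suc i))" by blast
      \<comment> \<open>An infinite run has prefixes of every length, contradicting the
        bound.\<close>
      obtain N where "real m * ?g a n < real N" using reals_Archimedean2 by blast
      then show False using bound[of R N] R by force
    qed
    moreover have "hopset G w (real \<beta>) H \<and> real (card H) \<le> real m * ?g a n"
      if out: "greedy_output G w \<beta> H" for H
    proof -
      obtain N where "(greedy_step G w \<beta> ^^ N) {} H"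
        using out unfolding greedy_output_def by (metis rtranclp_imp_relpowp)
      then obtain R where R: "R 0 = {}" "R N = H"
          "\<And>i. i < N \<Longrightarrow> greedy_step G w \<beta> (R i) (R (Suc i))"
        unfolding relpowp_fun_conv by auto
      have H: "H \<subseteq> TC G" "card H \<le> N"
        using greedy_run_subset[of R N G w \<beta> N, OF R(1,3)] R(2) by auto
      have "hopset G w (real \<beta>) H"
        using hopset_if_potential_eq_0[OF G H(1)] out unfolding greedy_output_def by simp
      moreover have "real (card H) \<le> real m * ?g a n"
        using bound[of R N] R H(2) by force
      ultimately show ?thesis ..
    qed
    ultimately show ?thesis by blast
  qed
  have C\<^sub>0: "n_pow_o1 ?C\<^sub>0"
    by (intro n_pow_o1_add n_pow_o1_mult n_pow_o1_const n_pow_o1_abs n_pow_o1_ln assms) auto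
  have g: "n_pow_o1 (\<lambda>n. ?g (X n) n)" if "n_pow_o1 X" for X
    using that
    by (intro n_pow_o1_add n_pow_o1_mult n_pow_o1_const n_pow_o1_abs n_pow_o1_ln assms) auto
  show ?thesis
  proof (rule exI[of _ ?C\<^sub>0], rule conjI[OF C\<^sub>0], intro allI impI)
    fix C\<^sub>1 X :: "nat \<Rightarrow> real"
    assume "n_pow_o1 X"
    show "\<exists>g. n_pow_o1 g \<and>
        (\<forall>(G :: 'a pair_pre_digraph) w n m \<beta>.
          weighted_graph G w \<longrightarrow> card (pverts G) = n \<longrightarrow> card (parcs G) = m \<longrightarrow>
          ereal_of_enat (exopt n (real m) (real \<beta> / 2)) \<le> ereal (real m * f n) \<longrightarrow>
          (\<exists>C x. ?C\<^sub>0 n \<le> C \<and> C \<le> C\<^sub>1 n \<and> 1 \<le> C * x \<and> x \<le> X n \<and>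
             critical C x n (real m) (real \<beta> / 2)) \<longrightarrow>
          greedy_terminates G w \<beta> \<and>
          (\<forall>H. greedy_output G w \<beta> H \<longrightarrow>
             hopset G w (real \<beta>) H \<and> real (card H) \<le> real m * g n))"
      by (rule exI, rule conjI[OF g[OF \<open>n_pow_o1 X\<close>]], intro allI impI, elim exE conjE, rule greedy)
  qed
qed

end
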